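(* Let $R$ be a $G$-graded ring and let $M$ be a $G$-graded $R$-module that is $G$-graded weakly topological. Then $\Upsilon_M$ (with the Zariski topology) is a $T_1$-space if and only if every element of $\Upsilon_M$ is a maximal element of $\Upsilon_M$. That is, with $\Omega=\{(D:_RM): D\in\Upsilon_M\}\subseteq GWSpec(R)$, $\Upsilon_M$ is a $T_1$-space if and only if (i) for every $C\in\Upsilon_M$, $p=(C:_RM)$ is a maximal element of the set $\Omega$, and (ii) $|\Upsilon_{M,p}|=1$ for every $p\in GWSpec(R)$.
   Context: $G$ is an abelian group with identity $e$. A ring $R$ is $G$-graded if $R=\bigoplus_{g\in G}R_g$ with additive subgroups $R_g$ satisfying $R_gR_h\subseteq R_{gh}$ for all $g,h\in G$; $h(R)=\bigcup_{g\in G}R_g$ is the set of homogeneous elements. An ideal $I$ of $R$ is graded if $I=\bigoplus_{g\in G}(I\cap R_g)$. A left $R$-module $M$ is a $G$-graded $R$-module if $M=\bigoplus_{g\in G}M_g$ with additive subgroups $M_g$ satisfying $R_gM_h\subseteq M_{gh}$ for all $g,h\in G$. A submodule $P$ of $M$ is graded if $P=\bigoplus_{g\in G}(P\cap M_g)$. Put $(P:_RM)=\{r\in R: rM\subseteq P\}$. A proper graded ideal $I$ of $R$ is graded weakly prime if whenever $a,b\in h(R)$ and $0\neq ab\in I$, then $a\in I$ or $b\in I$. $GWSpec(R)$ is the set of all graded weakly prime ideals of $R$. A graded submodule $P$ of $M$ is graded pseudo weakly prime if $(P:_RM)$ is a graded weakly prime ideal of $R$; $\Upsilon_M$ is the set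 of all graded pseudo weakly prime submodules of $M$, and for $I\in GWSpec(R)$, $\Upsilon_{M,I}=\{P\in\Upsilon_M:(P:_RM)=I\}$. A graded submodule of $M$ is graded pseudo weakly semiprime if it is an intersection of graded pseudo weakly prime submodules of $M$. A graded pseudo weakly prime submodule $P$ of $M$ is graded weakly extraordinary if whenever $I,J$ are graded pseudo weakly semiprime submodules of $M$ with $\{0\}\neq I\cap J\subseteq P$, then $I\subseteq P$ or $J\subseteq P$. $M$ is $G$-graded weakly topological if $\Upsilon_M=\emptyset$ or every graded pseudo weakly prime submodule of $M$ is graded weakly extraordinary. For a graded submodule $N$ of $M$, $\chi(N)=\{I\in\Upsilon_M: N\subseteq I\}$. The Zariski topology on $\Upsilon_M$ is the topology whose closed sets are the sets $\chi(N)$, with $N$ a graded submodule of $M$.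
   Formalization: Condition (ii) is required only for p with Υ_{M,p} nonempty (literally it fails for R=Z, M=Z/2, p=3Z); the Zariski topology is the coarsest one in which all χ(N) are closed, since the χ(N) need not be the closed sets of a topology. *)

theory Defs
  imports "HOL-Algebra.Module" "HOL-Algebra.Ideal" "HOL-Analysis.T1_Spaces"
begin

section \<open>Modules over a ring that need not be commutative\<close>

text \<open>The library locale \<^locale>\<open>Module.module\<close> presupposes a commutative ring. The following locale has
  the same axioms for left modules over an arbitrary ring with unity.\<close>

locale left_module = R?: ring R + M?: abelian_group M
  for R :: "('a, 'k) ring_scheme" (structure) and M :: "('a, 'b, 'm) module_scheme" (structure) +
  assumes smult_closed:
      "\<lbrakk>a \<in> carrier R; x \<in> carrier M\<rbrakk> \<Longrightarrow> a \<odot>\<^bsub>M\<^esub> x \<in> carrier M"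
    and smult_l_distr:
      "\<lbrakk>a \<in> carrier R; b \<in> carrier R; x \<in> carrier M\<rbrakk> \<Longrightarrow>
        (a \<oplus> b) \<odot>\<^bsub>M\<^esub> x = a \<odot>\<^bsub>M\<^esub> x \<oplus>\<^bsub>M\<^esub> b \<odot>\<^bsub>M\<^esub> x"
    and smult_r_distr:
      "\<lbrakk>a \<in> carrier R; x \<in> carrier M; y \<in> carrier M\<rbrakk> \<Longrightarrow>
        a \<odot>\<^bsub>M\<^esub> (x \<oplus>\<^bsub>M\<^esub> y) = a \<odot>\<^bsub>M\<^esub> x \<oplus>\<^bsub>M\<^esub> a \<odot>\<^bsub>M\<^esub> y"
    and smult_assoc1:
      "\<lbrakk>a \<in> carrier R; b \<in> carrier R; x \<in> carrier M\<rbrakk> \<Longrightarrow>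
        (a \<otimes> b) \<odot>\<^bsub>M\<^esub> x = a \<odot>\<^bsub>M\<^esub> (b \<odot>\<^bsub>M\<^esub> x)"
    and smult_one:
      "x \<in> carrier M \<Longrightarrow> \<one> \<odot>\<^bsub>M\<^esub> x = x"

lemma left_module_if_module: "Module.module R M \<Longrightarrow> left_module R M"
  by (auto simp: Module.module_def Module.module_axioms_def cring_def
      intro!: left_module.intro left_module_axioms.intro)


section \<open>Gradings\<close>

text \<open>\<open>S\<close> is the internal direct sum of the additive subgroups \<open>A i\<close>, \<open>i \<in> I\<close>: summation is a
  bijection from the external direct sum (the finitely supported families) onto \<open>S\<close>.\<close>

definition internal_direct_sum ::
  "('a, 'z) ring_scheme \<Rightarrow> 'i set \<Rightarrow> ('i \<Rightarrow> 'a set) \<Rightarrow> 'a set \<Rightarrow> bool"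
  where "internal_direct_sum X I A S \<longleftrightarrow>
    (\<forall>i\<in>I. additive_subgroup (A i) X) \<and>
    bij_betw (\<lambda>f. finsum X f {i \<in> I. f i \<noteq> \<zero>\<^bsub>X\<^esub>})
      {f \<in> PiE I A. finite {i \<in> I. f i \<noteq> \<zero>\<^bsub>X\<^esub>}} S"

locale graded_ring = G?: comm_group G + R?: ring R
  for G :: "('g, 'n) monoid_scheme" and R :: "('r, 'k) ring_scheme"
  and Rg :: "'g \<Rightarrow> 'r set" +
  assumes ring_decomposition: "internal_direct_sum R (carrier G) Rg (carrier R)"
    and ring_grading: "\<lbrakk>g \<in> carrier G; h \<in> carrier G; a \<in> Rg g; b \<in> Rg h\<rbrakk>
      \<Longrightarrow> a \<otimes>\<^bsub>R\<^esub> b \<in> Rg (g \<otimes>\<^bsub>G\<^esub> h)"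

locale graded_module = graded_ring G R Rg + left_module R M
  for G :: "('g, 'n) monoid_scheme" and R :: "('r, 'k) ring_scheme"
  and Rg :: "'g \<Rightarrow> 'r set" and M :: "('r, 'm, 'l) module_scheme" and Mg :: "'g \<Rightarrow> 'm set" +
  assumes module_decomposition: "internal_direct_sum M (carrier G) Mg (carrier M)"
    and module_grading: "\<lbrakk>g \<in> carrier G; h \<in> carrier G; a \<in> Rg g; x \<in> Mg h\<rbrakk>
      \<Longrightarrow> a \<odot>\<^bsub>M\<^esub> x \<in> Mg (g \<otimes>\<^bsub>G\<^esub> h)"

definition homogeneous :: "('g, 'n) monoid_scheme \<Rightarrow> ('g \<Rightarrow> 'r set) \<Rightarrow> 'r set"
  where "homogeneous G Rg = (\<Union>g\<in>carrier G. Rg g)"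

definition graded_ideal ::
  "('g, 'n) monoid_scheme \<Rightarrow> ('r, 'k) ring_scheme \<Rightarrow> ('g \<Rightarrow> 'r set) \<Rightarrow> 'r set \<Rightarrow> bool"
  where "graded_ideal G R Rg I \<longleftrightarrow>
    ideal I R \<and> internal_direct_sum R (carrier G) (\<lambda>g. I \<inter> Rg g) I"

definition graded_submodule ::
  "('g, 'n) monoid_scheme \<Rightarrow> ('r, 'k) ring_scheme \<Rightarrow>
    ('r, 'm, 'l) module_scheme \<Rightarrow> ('g \<Rightarrow> 'm set) \<Rightarrow> 'm set \<Rightarrow> bool"
  where "graded_submodule G R M Mg P \<longleftrightarrow>
    submodule P R M \<and> internal_direct_sum M (carrier G) (\<lambda>g. P \<inter> Mg g) P"

definition residual ::
  "('r, 'k) ring_scheme \<Rightarrow> ('r, 'm, 'l) module_scheme \<Rightarrow> 'm set \<Rightarrow> 'r set"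
  where "residual R M P = {r \<in> carrier R. \<forall>x\<in>carrier M. r \<odot>\<^bsub>M\<^esub> x \<in> P}"


section \<open>Graded weakly prime ideals and graded pseudo weakly prime submodules\<close>

definition graded_weakly_prime ::
  "('g, 'n) monoid_scheme \<Rightarrow> ('r, 'k) ring_scheme \<Rightarrow> ('g \<Rightarrow> 'r set) \<Rightarrow> 'r set \<Rightarrow> bool"
  where "graded_weakly_prime G R Rg I \<longleftrightarrow>
    graded_ideal G R Rg I \<and> I \<noteq> carrier R \<and>
    (\<forall>a\<in>homogeneous G Rg. \<forall>b\<in>homogeneous G Rg.
      a \<otimes>\<^bsub>R\<^esub> b \<noteq> \<zero>\<^bsub>R\<^esub> \<and> a \<otimes>\<^bsub>R\<^esub> b \<in> I \<longrightarrow> a \<in> I \<or> b \<in> I)"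

definition GWSpec ::
  "('g, 'n) monoid_scheme \<Rightarrow> ('r, 'k) ring_scheme \<Rightarrow> ('g \<Rightarrow> 'r set) \<Rightarrow> 'r set set"
  where "GWSpec G R Rg = {I. graded_weakly_prime G R Rg I}"

definition graded_pseudo_weakly_prime ::
  "('g, 'n) monoid_scheme \<Rightarrow> ('r, 'k) ring_scheme \<Rightarrow> ('g \<Rightarrow> 'r set) \<Rightarrow>
    ('r, 'm, 'l) module_scheme \<Rightarrow> ('g \<Rightarrow> 'm set) \<Rightarrow> 'm set \<Rightarrow> bool"
  where "graded_pseudo_weakly_prime G R Rg M Mg P \<longleftrightarrow>
    graded_submodule G R M Mg P \<and> graded_weakly_prime G R Rg (residual R M P)"

definition Upsilon ::
  "('g, 'n) monoid_scheme \<Rightarrow> ('r, 'k) ring_scheme \<Rightarrow> ('g \<Rightarrow> 'r set) \<Rightarrow>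
    ('r, 'm, 'l) module_scheme \<Rightarrow> ('g \<Rightarrow> 'm set) \<Rightarrow> 'm set set"
  where "Upsilon G R Rg M Mg = {P. graded_pseudo_weakly_prime G R Rg M Mg P}"

definition Upsilon_at ::
  "('g, 'n) monoid_scheme \<Rightarrow> ('r, 'k) ring_scheme \<Rightarrow> ('g \<Rightarrow> 'r set) \<Rightarrow>
    ('r, 'm, 'l) module_scheme \<Rightarrow> ('g \<Rightarrow> 'm set) \<Rightarrow> 'r set \<Rightarrow> 'm set set"
  where "Upsilon_at G R Rg M Mg I = {P \<in> Upsilon G R Rg M Mg. residual R M P = I}"

definition Omega ::
  "('g, 'n) monoid_scheme \<Rightarrow> ('r, 'k) ring_scheme \<Rightarrow> ('g \<Rightarrow> 'r set) \<Rightarrow>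
    ('r, 'm, 'l) module_scheme \<Rightarrow> ('g \<Rightarrow> 'm set) \<Rightarrow> 'r set set"
  where "Omega G R Rg M Mg = {residual R M D | D. D \<in> Upsilon G R Rg M Mg}"

text \<open>Intersections are taken over nonempty families. Admitting the empty family, with intersection
  \<open>carrier M\<close>, would add no condition to \<open>graded_weakly_extraordinary\<close> below: for \<open>I = carrier M\<close>
  the hypothesis \<open>I \<inter> J \<subseteq> P\<close> already says \<open>J \<subseteq> P\<close>.\<close>

definition graded_pseudo_weakly_semiprime ::
  "('g, 'n) monoid_scheme \<Rightarrow> ('r, 'k) ring_scheme \<Rightarrow> ('g \<Rightarrow> 'r set) \<Rightarrow>
    ('r, 'm, 'l) module_scheme \<Rightarrow> ('g \<Rightarrow> 'm set) \<Rightarrow> 'm set \<Rightarrow> bool"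
  where "graded_pseudo_weakly_semiprime G R Rg M Mg N \<longleftrightarrow>
    graded_submodule G R M Mg N \<and>
    (\<exists>\<F>. \<F> \<noteq> {} \<and> \<F> \<subseteq> Upsilon G R Rg M Mg \<and> N = \<Inter>\<F>)"

definition graded_weakly_extraordinary ::
  "('g, 'n) monoid_scheme \<Rightarrow> ('r, 'k) ring_scheme \<Rightarrow> ('g \<Rightarrow> 'r set) \<Rightarrow>
    ('r, 'm, 'l) module_scheme \<Rightarrow> ('g \<Rightarrow> 'm set) \<Rightarrow> 'm set \<Rightarrow> bool"
  where "graded_weakly_extraordinary G R Rg M Mg P \<longleftrightarrow>
    graded_pseudo_weakly_prime G R Rg M Mg P \<and>
    (\<forall>I J. graded_pseudo_weakly_semiprime G R Rg M Mg I \<and>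
       graded_pseudo_weakly_semiprime G R Rg M Mg J \<and>
       {\<zero>\<^bsub>M\<^esub>} \<noteq> I \<inter> J \<and> I \<inter> J \<subseteq> P \<longrightarrow> I \<subseteq> P \<or> J \<subseteq> P)"

definition graded_weakly_topological ::
  "('g, 'n) monoid_scheme \<Rightarrow> ('r, 'k) ring_scheme \<Rightarrow> ('g \<Rightarrow> 'r set) \<Rightarrow>
    ('r, 'm, 'l) module_scheme \<Rightarrow> ('g \<Rightarrow> 'm set) \<Rightarrow> bool"
  where "graded_weakly_topological G R Rg M Mg \<longleftrightarrow>
    Upsilon G R Rg M Mg = {} \<or>
    (\<forall>P. graded_pseudo_weakly_prime G R Rg M Mg P \<longrightarrow>
      graded_weakly_extraordinary G R Rg M Mg P)"


section \<open>The Zariski topology\<close>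

definition chi ::
  "('g, 'n) monoid_scheme \<Rightarrow> ('r, 'k) ring_scheme \<Rightarrow> ('g \<Rightarrow> 'r set) \<Rightarrow>
    ('r, 'm, 'l) module_scheme \<Rightarrow> ('g \<Rightarrow> 'm set) \<Rightarrow> 'm set \<Rightarrow> 'm set set"
  where "chi G R Rg M Mg N = {I \<in> Upsilon G R Rg M Mg. N \<subseteq> I}"

text \<open>The sets \<open>chi N\<close> need not be closed under finite unions, even if \<open>M\<close> is graded weakly
  topological: for a field \<open>k\<close> and \<open>M = R = k \<times> k\<close>, trivially graded, \<open>Upsilon\<close> consists of \<open>0\<close>,
  \<open>k \<times> 0\<close> and \<open>0 \<times> k\<close>, and \<open>{k \<times> 0, 0 \<times> k}\<close> is not of the form \<open>chi N\<close>. Hence the Zariski topology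
  is defined as the coarsest topology in which every \<open>chi N\<close> is closed. If the \<open>chi N\<close> are the
  closed sets of some topology, this is that topology (lemma \<open>closedin_zariski_topology_iff\<close>).\<close>

definition zariski_topology ::
  "('g, 'n) monoid_scheme \<Rightarrow> ('r, 'k) ring_scheme \<Rightarrow> ('g \<Rightarrow> 'r set) \<Rightarrow>
    ('r, 'm, 'l) module_scheme \<Rightarrow> ('g \<Rightarrow> 'm set) \<Rightarrow> 'm set topology"
  where "zariski_topology G R Rg M Mg = topology_generated_by
    {Upsilon G R Rg M Mg - chi G R Rg M Mg N | N. graded_submodule G R M Mg N}"

lemma topspace_zariski_topology:
  assumes "graded_module G R Rg M Mg"
  shows "topspace (zariski_topology G R Rg M Mg) = Upsilon G R Rg M Mg"
proof -
  interpret graded_module G R Rg M Mg by (rule assms)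
  have sub: "carrier M \<inter> Mg g = Mg g" if "g \<in> carrier G" for g
    using module_decomposition that additive_subgroup.a_subset
    unfolding internal_direct_sum_def by blast
  have "internal_direct_sum M (carrier G) (\<lambda>g. carrier M \<inter> Mg g) (carrier M)"
    using module_decomposition sub unfolding internal_direct_sum_def
    by (simp cong: PiE_cong)
  moreover have "submodule (carrier M) R M"
    by (intro submodule.intro submodule_axioms.intro M.add.subgroup_self smult_closed)
  ultimately have "graded_submodule G R M Mg (carrier M)"
    unfolding graded_submodule_def by blast
  moreover have "chi G R Rg M Mg (carrier M) = {}"
  proof -
    have "residual R M P = carrier R" if "carrier M \<subseteq> P" for P
      using that smult_closed unfolding residual_def by blast
    then show ?thesis
      unfolding chi_def Upsilon_def graded_pseudo_weakly_prime_def graded_weakly_prime_def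
      by blast
  qed
  ultimately show ?thesis
    unfolding zariski_topology_def topology_generated_by_topspace by blast
qed

lemma closedin_zariski_topology_iff:
  assumes "topspace T = Upsilon G R Rg M Mg"
    and T: "\<And>C. closedin T C \<longleftrightarrow> (\<exists>N. graded_submodule G R M Mg N \<and> C = chi G R Rg M Mg N)"
  shows "zariski_topology G R Rg M Mg = T"
    and "closedin (zariski_topology G R Rg M Mg) C \<longleftrightarrow>
      (\<exists>N. graded_submodule G R M Mg N \<and> C = chi G R Rg M Mg N)"
proof -
  let ?B = "{Upsilon G R Rg M Mg - chi G R Rg M Mg N | N. graded_submodule G R M Mg N}"
  have B: "openin T U \<longleftrightarrow> U \<in> ?B" for U
  proof
    assume U: "openin T U"
    then have "closedin T (topspace T - U)" by blast
    then obtain N where N: "graded_submodule G R M Mg N" "topspace T - U = chi G R Rg M Mg N"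
      using T by blast
    have "U = topspace T - (topspace T - U)"
      using openin_subset[OF U] by blast
    then have "U = Upsilon G R Rg M Mg - chi G R Rg M Mg N"
      using N(2) assms(1) by metis
    with N(1) show "U \<in> ?B" by blast
  next
    assume "U \<in> ?B"
    then obtain N where N: "graded_submodule G R M Mg N"
      "U = topspace T - chi G R Rg M Mg N"
      using assms(1) by auto
    then have "closedin T (chi G R Rg M Mg N)" using T by blast
    with N(2) show "openin T U" by blast
  qed
  have "generate_topology_on ?B U \<Longrightarrow> openin T U" for U
  proof (induction rule: generate_topology_on.induct)
    case (Basis s)
    then show ?case using B by blast
  qed (auto simp: openin_Int openin_Union)
  moreover have "openin T U \<Longrightarrow> generate_topology_on ?B U" for U
    by (simp only: B generate_topology_on.Basis)
  ultimately have "openin (topology_generated_by ?B) U \<longleftrightarrow> openin T U" for U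
    unfolding openin_topology_generated_by_iff by (rule iffI)
  then show *: "zariski_topology G R Rg M Mg = T"
    unfolding zariski_topology_def topology_eq by (rule allI)
  show "closedin (zariski_topology G R Rg M Mg) C \<longleftrightarrow>
      (\<exists>N. graded_submodule G R M Mg N \<and> C = chi G R Rg M Mg N)"
    unfolding * by (rule T)
qed

definition maximal_in :: "'a set set \<Rightarrow> 'a set \<Rightarrow> bool"
  where "maximal_in \<A> A \<longleftrightarrow> A \<in> \<A> \<and> (\<forall>B\<in>\<A>. A \<subseteq> B \<longrightarrow> B = A)"

end

theory Submission
  imports Defs
begin

text \<open>Everything rests on two observations.

  The subbasic open sets \<open>Upsilon - chi N\<close> are closed under passing to smaller members of
  \<open>Upsilon\<close>, hence so is every Zariski open set. If \<open>P \<subset> Q\<close> in \<open>Upsilon\<close>, no open set can therefore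
  contain \<open>Q\<close> and omit \<open>P\<close>, so in a \<open>T\<^sub>1\<close>-space all members of \<open>Upsilon\<close> are maximal. Conversely, if
  \<open>P\<close> is maximal then \<open>{P} = chi P\<close> is closed.

  If \<open>C\<close> and \<open>D\<close> lie in \<open>Upsilon\<close> and \<open>(C : M) \<subseteq> (D : M)\<close>, then \<open>C \<inter> D\<close> is a graded submodule whose
  residual is \<open>(C : M) \<inter> (D : M) = (C : M)\<close>, so \<open>C \<inter> D\<close> again lies in \<open>Upsilon\<close> (lemma
  \<open>Int_in_Upsilon\<close>). When all members of \<open>Upsilon\<close> are maximal this forces \<open>C = C \<inter> D = D\<close>, which
  gives at once that every residual is maximal in \<open>Omega\<close> and that the fibres \<open>Upsilon_at p\<close> have at
  most one element. The converse holds because taking residuals is monotone.\<close>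

text \<open>The components of an element of \<open>B \<inter> C\<close> taken in \<open>B\<close> and those taken in \<open>C\<close> agree, since both
  are its components in \<open>S\<close>.\<close>

lemma internal_direct_sum_Int:
  assumes "abelian_group X"
    and S: "internal_direct_sum X I A S"
    and B: "internal_direct_sum X I (\<lambda>i. B \<inter> A i) B"
    and C: "internal_direct_sum X I (\<lambda>i. C \<inter> A i) C"
  shows "internal_direct_sum X I (\<lambda>i. (B \<inter> C) \<inter> A i) (B \<inter> C)"
proof -
  interpret abelian_group X by (rule assms(1))
  let ?s = "\<lambda>f. finsum X f {i \<in> I. f i \<noteq> \<zero>\<^bsub>X\<^esub>}"
  let ?E = "\<lambda>A. {f \<in> PiE I A. finite {i \<in> I. f i \<noteq> \<zero>\<^bsub>X\<^esub>}}"
  have bij: "bij_betw ?s (?E A) S" "bij_betw ?s (?E (\<lambda>i. B \<inter> A i)) B"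
    "bij_betw ?s (?E (\<lambda>i. C \<inter> A i)) C"
    using S B C unfolding internal_direct_sum_def by simp_all
  have inj: "inj_on ?s (?E A)"
    using bij(1) by (rule bij_betw_imp_inj_on)
  have sub: "?E (\<lambda>i. B \<inter> A i) \<subseteq> ?E A" "?E (\<lambda>i. C \<inter> A i) \<subseteq> ?E A"
    by (auto simp: PiE_def Pi_def)
  have E: "?E (\<lambda>i. (B \<inter> C) \<inter> A i) = ?E (\<lambda>i. B \<inter> A i) \<inter> ?E (\<lambda>i. C \<inter> A i)"
    by (auto simp: PiE_def Pi_def)
  have "?s ` ?E (\<lambda>i. (B \<inter> C) \<inter> A i) = B \<inter> C"
    unfolding E inj_on_image_Int[OF inj sub]
    using bij(2,3)[THEN bij_betw_imp_surj_on] by simp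
  moreover have "inj_on ?s (?E (\<lambda>i. (B \<inter> C) \<inter> A i))"
    by (rule inj_on_subset[OF inj]) (use E sub in blast)
  ultimately have "bij_betw ?s (?E (\<lambda>i. (B \<inter> C) \<inter> A i)) (B \<inter> C)"
    unfolding bij_betw_def by blast
  moreover have "additive_subgroup ((B \<inter> C) \<inter> A i) X" if "i \<in> I" for i
  proof -
    have "subgroup (B \<inter> A i) (add_monoid X)" "subgroup (C \<inter> A i) (add_monoid X)"
      using B C that unfolding internal_direct_sum_def additive_subgroup_def by simp_all
    then have "subgroup ((B \<inter> A i) \<inter> (C \<inter> A i)) (add_monoid X)"
      by (rule add.subgroups_Inter_pair)
    moreover have "(B \<inter> A i) \<inter> (C \<inter> A i) = (B \<inter> C) \<inter> A i" by blast
    ultimately show ?thesis by (simp add: additive_subgroup_def)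
  qed
  ultimately show ?thesis unfolding internal_direct_sum_def by blast
qed

lemma graded_submodule_Int:
  assumes "graded_module G R Rg M Mg"
    and P: "graded_submodule G R M Mg P" and Q: "graded_submodule G R M Mg Q"
  shows "graded_submodule G R M Mg (P \<inter> Q)"
proof -
  interpret graded_module G R Rg M Mg by (rule assms(1))
  have sm: "submodule P R M" "submodule Q R M"
    using P Q unfolding graded_submodule_def by simp_all
  have "subgroup (P \<inter> Q) (add_monoid M)"
    using sm by (intro M.add.subgroups_Inter_pair) (simp_all add: submodule_def)
  then have "submodule (P \<inter> Q) R M"
    using sm by (simp add: submodule_def submodule_axioms_def)
  moreover have "internal_direct_sum M (carrier G) (\<lambda>g. (P \<inter> Q) \<inter> Mg g) (P \<inter> Q)"
    using P Q unfolding graded_submodule_def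
    by (intro internal_direct_sum_Int[OF M.abelian_group_axioms module_decomposition]) simp_all
  ultimately show ?thesis unfolding graded_submodule_def by blast
qed

lemma residual_mono: "P \<subseteq> Q \<Longrightarrow> residual R M P \<subseteq> residual R M Q"
  unfolding residual_def by blast

lemma residual_Int: "residual R M (P \<inter> Q) = residual R M P \<inter> residual R M Q"
  unfolding residual_def by blast

lemma Int_in_Upsilon:
  assumes "graded_module G R Rg M Mg"
    and "C \<in> Upsilon G R Rg M Mg" and "graded_submodule G R M Mg D"
    and "residual R M C \<subseteq> residual R M D"
  shows "C \<inter> D \<in> Upsilon G R Rg M Mg"
proof -
  have "residual R M (C \<inter> D) = residual R M C"
    using assms(4) by (simp add: residual_Int Int_absorb2)
  then show ?thesis
    using assms(2,3) graded_submodule_Int[OF assms(1)]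
    by (simp add: Upsilon_def graded_pseudo_weakly_prime_def)
qed

lemma openin_zariski_topology_downward_closed:
  assumes "openin (zariski_topology G R Rg M Mg) U"
    and "Q \<in> U" and "P \<in> Upsilon G R Rg M Mg" and "P \<subseteq> Q"
  shows "P \<in> U"
proof -
  have "generate_topology_on
      {Upsilon G R Rg M Mg - chi G R Rg M Mg N | N. graded_submodule G R M Mg N} U"
    using assms(1) by (simp add: zariski_topology_def openin_topology_generated_by_iff)
  then show ?thesis
    using assms(2)
  proof (induction rule: generate_topology_on.induct)
    case (Basis s)
    then obtain N where "s = Upsilon G R Rg M Mg - chi G R Rg M Mg N" by blast
    with Basis.prems assms(3,4) show ?case unfolding chi_def by blast
  qed blast+
qed

lemma closedin_zariski_topology_chi:
  assumes "graded_module G R Rg M Mg" and "graded_submodule G R M Mg N"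
  shows "closedin (zariski_topology G R Rg M Mg) (chi G R Rg M Mg N)"
proof -
  have "openin (zariski_topology G R Rg M Mg) (Upsilon G R Rg M Mg - chi G R Rg M Mg N)"
    unfolding zariski_topology_def by (rule topology_generated_by_Basis) (use assms(2) in blast)
  then show ?thesis
    by (auto simp: closedin_def topspace_zariski_topology[OF assms(1)] chi_def)
qed

lemma t1_space_zariski_topology_iff:
  assumes "graded_module G R Rg M Mg"
  shows "t1_space (zariski_topology G R Rg M Mg) \<longleftrightarrow>
    (\<forall>C\<in>Upsilon G R Rg M Mg. maximal_in (Upsilon G R Rg M Mg) C)"
proof
  assume t1: "t1_space (zariski_topology G R Rg M Mg)"
  have "D = C"
    if "C \<in> Upsilon G R Rg M Mg" "D \<in> Upsilon G R Rg M Mg" "C \<subseteq> D" for C D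
  proof (rule ccontr)
    assume "D \<noteq> C"
    with t1 that obtain U where "openin (zariski_topology G R Rg M Mg) U" "D \<in> U" "C \<notin> U"
      unfolding t1_space_def topspace_zariski_topology[OF assms] by blast
    with that show False
      using openin_zariski_topology_downward_closed by metis
  qed
  then show "\<forall>C\<in>Upsilon G R Rg M Mg. maximal_in (Upsilon G R Rg M Mg) C"
    unfolding maximal_in_def by blast
next
  assume max: "\<forall>C\<in>Upsilon G R Rg M Mg. maximal_in (Upsilon G R Rg M Mg) C"
  have "closedin (zariski_topology G R Rg M Mg) {C}" if C: "C \<in> Upsilon G R Rg M Mg" for C
  proof -
    have "chi G R Rg M Mg C = {C}"
      using max C unfolding chi_def maximal_in_def by blast
    moreover have "graded_submodule G R M Mg C"
      using C by (simp add: Upsilon_def graded_pseudo_weakly_prime_def)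
    ultimately show ?thesis
      using closedin_zariski_topology_chi[OF assms] by metis
  qed
  then show "t1_space (zariski_topology G R Rg M Mg)"
    by (simp add: t1_space_closedin_singleton topspace_zariski_topology[OF assms])
qed

lemma all_maximal_in_Upsilon_iff:
  assumes "graded_module G R Rg M Mg"
  shows "(\<forall>C\<in>Upsilon G R Rg M Mg. maximal_in (Upsilon G R Rg M Mg) C) \<longleftrightarrow>
    (\<forall>C\<in>Upsilon G R Rg M Mg. maximal_in (Omega G R Rg M Mg) (residual R M C)) \<and>
    (\<forall>p\<in>GWSpec G R Rg. Upsilon_at G R Rg M Mg p \<noteq> {} \<longrightarrow>
      card (Upsilon_at G R Rg M Mg p) = 1)"
    (is "?max \<longleftrightarrow> ?res \<and> ?fib")
proof
  assume max: ?max
  have eq: "C = D"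
    if C: "C \<in> Upsilon G R Rg M Mg" and D: "D \<in> Upsilon G R Rg M Mg"
      and le: "residual R M C \<subseteq> residual R M D" for C D
  proof -
    have "C \<inter> D \<in> Upsilon G R Rg M Mg"
      using Int_in_Upsilon[OF assms C _ le] D
      by (simp add: Upsilon_def graded_pseudo_weakly_prime_def)
    with max C D show ?thesis
      unfolding maximal_in_def by (metis Int_lower1 Int_lower2)
  qed
  have ?res
    unfolding maximal_in_def Omega_def using eq by blast
  moreover have "card (Upsilon_at G R Rg M Mg p) = 1" if "Upsilon_at G R Rg M Mg p \<noteq> {}" for p
  proof -
    from that obtain C where C: "C \<in> Upsilon_at G R Rg M Mg p" by blast
    then have "Upsilon_at G R Rg M Mg p = {C}"
      unfolding Upsilon_at_def using eq by blast
    then show ?thesis by simp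
  qed
  ultimately show "?res \<and> ?fib" by blast
next
  assume "?res \<and> ?fib"
  then have res: ?res and fib: ?fib by simp_all
  have "D = C"
    if C: "C \<in> Upsilon G R Rg M Mg" and D: "D \<in> Upsilon G R Rg M Mg" and "C \<subseteq> D" for C D
  proof -
    have "residual R M D \<in> Omega G R Rg M Mg"
      using D unfolding Omega_def by blast
    moreover have "maximal_in (Omega G R Rg M Mg) (residual R M C)"
      using res C by simp
    ultimately have "residual R M D = residual R M C"
      using residual_mono[OF \<open>C \<subseteq> D\<close>, of R M] by (simp add: maximal_in_def)
    then have mem: "C \<in> Upsilon_at G R Rg M Mg (residual R M C)"
      "D \<in> Upsilon_at G R Rg M Mg (residual R M C)"
      using C D by (simp_all add: Upsilon_at_def)
    have "residual R M C \<in> GWSpec G R Rg"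
      using C by (simp add: Upsilon_def graded_pseudo_weakly_prime_def GWSpec_def)
    with fib mem(1) have "card (Upsilon_at G R Rg M Mg (residual R M C)) = 1" by blast
    with mem show ?thesis by (metis card_1_singletonE singletonD)
  qed
  then show ?max unfolding maximal_in_def by blast
qed

lemma Omega_subset_GWSpec: "Omega G R Rg M Mg \<subseteq> GWSpec G R Rg"
  by (auto simp: Omega_def Upsilon_def graded_pseudo_weakly_prime_def GWSpec_def)

theorem theorem3p5:
  fixes G :: "('g, 'n) monoid_scheme"
    and R :: "('r, 'k) ring_scheme" and Rg :: "'g \<Rightarrow> 'r set"
    and M :: "('r, 'm, 'l) module_scheme" and Mg :: "'g \<Rightarrow> 'm set"
  assumes "graded_module G R Rg M Mg"
    and "graded_weakly_topological G R Rg M Mg"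
  shows "(t1_space (zariski_topology G R Rg M Mg) \<longleftrightarrow>
      (\<forall>C\<in>Upsilon G R Rg M Mg. maximal_in (Upsilon G R Rg M Mg) C)) \<and>
    Omega G R Rg M Mg \<subseteq> GWSpec G R Rg \<and>
    (t1_space (zariski_topology G R Rg M Mg) \<longleftrightarrow>
      (\<forall>C\<in>Upsilon G R Rg M Mg. maximal_in (Omega G R Rg M Mg) (residual R M C)) \<and>
      (\<forall>p\<in>GWSpec G R Rg. Upsilon_at G R Rg M Mg p \<noteq> {} \<longrightarrow>
        card (Upsilon_at G R Rg M Mg p) = 1))"
  using t1_space_zariski_topology_iff[OF assms(1)] all_maximal_in_Upsilon_iff[OF assms(1)]
    Omega_subset_GWSpec[of G R Rg M Mg]
  by blast

end
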